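(* Let $n\in\mathbb{N}$, let $\mathbb{Z}^n=\langle x_1,\ldots,x_n\mid [x_i,x_j]\text{ whenever }i\neq j\rangle$, and let $G=\mathbb{Z}^n\rtimes_\phi \mathbb{Z}/2\mathbb{Z}$, where either $\phi(x_i)=x_i^{-1}$ for some $i\in\{1,\ldots,n\}$ and $\phi(x_k)=x_k$ for all $k\in\{1,\ldots,n\}\setminus\{i\}$, or $\phi(x_i)=x_j$ for some $i,j\in\{1,\ldots,n\}$ with $i\neq j$ and $\phi(x_k)=x_k$ for all $k\in\{1,\ldots,n\}\setminus\{i,j\}$. Let $\Gamma$ be any finitely generated group with a quotient isomorphic to $G$. Then for every finite symmetric generating set $A$ of $\Gamma$, the geodesic language $\mathsf{Geo}(\Gamma,A)$ is not piecewise excluding.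
   Context: Here $[x,y]=xyx^{-1}y^{-1}$, and $\phi$ denotes the automorphism of $\mathbb{Z}^n$ by which the nontrivial element of $\mathbb{Z}/2\mathbb{Z}$ acts in the semidirect product (so $\phi^2=\mathrm{id}$; in the second case this forces $\phi(x_j)=x_i$). A generating set $A$ of a group $\Gamma$ is symmetric if it is inverse-closed: $A$ is a subset of $\Gamma$ generating $\Gamma$ and $a\in A$ implies $a^{-1}\in A$ (the identity element is allowed to belong to $A$). $A^*$ denotes the set of all finite words over the alphabet $A$, including the empty word. A word $w\in A^*$ is geodesic if it labels a path of minimal length between two vertices of the Cayley graph of $\Gamma$ over $A$; equivalently, no strictly shorter word over $A$ represents the same element of $\Gamma$ as $w$. The geodesic language $\mathsf{Geo}(\Gamma,A)\subseteq A^*$ is the set of all geodesic words. A word $a_1a_2\cdots a_n$ ($a_i\in A$) is a piecewise subword of $w\in A^*$ if $w=w_0a_1w_1a_2\cdots a_nw_n$ for some $w_i\in A^*$ (i.e. it is a not necessarily contiguous subsequence of $w$). A language $L\subseteq A^*$ is piecewise excluding if there is a finite set $F\subset A^*$ such that, for all $w\in A^*$, $w\in L$ if and only if $w$ contains no piecewise subword in $F$. *)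

theory Defs
  imports "HOL-Algebra.Algebra" "HOL-Library.Sublist"
begin

definition free_abelian :: "nat \<Rightarrow> (nat \<Rightarrow> int) monoid" where
  "free_abelian n = product_group {1..n} (\<lambda>_. integer_group)"

text \<open>The standard basis vector \<open>x\<^sub>i\<close> of \<open>\<int>\<^sup>n\<close>; it lies in the carrier for \<open>i \<in> {1..n}\<close>.\<close>

definition basis_elt :: "nat \<Rightarrow> nat \<Rightarrow> (nat \<Rightarrow> int)" where
  "basis_elt n i = (\<lambda>k\<in>{1..n}. if k = i then 1 else 0)"

text \<open>External semidirect product; the intended actions are
  \<open>\<theta> \<in> hom H (AutoGroup N)\<close>, see the lemma below.\<close>

definition semidirect_product ::
    "('a, 'm) monoid_scheme \<Rightarrow> ('b, 'k) monoid_scheme \<Rightarrow> ('b \<Rightarrow> 'a \<Rightarrow> 'a) \<Rightarrow> ('a \<times> 'b) monoid" where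
  "semidirect_product N H \<theta> =
     \<lparr>carrier = carrier N \<times> carrier H,
      monoid.mult = (\<lambda>(a, h) (b, k). (a \<otimes>\<^bsub>N\<^esub> \<theta> h b, h \<otimes>\<^bsub>H\<^esub> k)),
      one = (\<one>\<^bsub>N\<^esub>, \<one>\<^bsub>H\<^esub>)\<rparr>"

lemma group_semidirect_product:
  assumes N: "group N" and H: "group H" and \<theta>: "\<theta> \<in> hom H (AutoGroup N)"
  shows "group (semidirect_product N H \<theta>)"
proof -
  interpret N: group N by (fact N)
  interpret H: group H by (fact H)
  interpret A: group "AutoGroup N" by (fact N.AutoGroup)
  interpret T: group_hom H "AutoGroup N" \<theta>
    by unfold_locales (fact \<theta>)
  have aut: "\<theta> h \<in> auto N" if "h \<in> carrier H" for h
    using T.hom_closed[OF that] by (simp add: AutoGroup_def)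
  have closed: "\<theta> h a \<in> carrier N" if "h \<in> carrier H" "a \<in> carrier N" for h a
    using aut[OF that(1)] that(2) by (auto simp: auto_def hom_def)
  have dist: "\<theta> h (a \<otimes>\<^bsub>N\<^esub> b) = \<theta> h a \<otimes>\<^bsub>N\<^esub> \<theta> h b"
    if "h \<in> carrier H" "a \<in> carrier N" "b \<in> carrier N" for h a b
    using aut[OF that(1)] that(2,3) by (auto simp: auto_def hom_def)
  have act: "\<theta> (h \<otimes>\<^bsub>H\<^esub> k) a = \<theta> h (\<theta> k a)"
    if "h \<in> carrier H" "k \<in> carrier H" "a \<in> carrier N" for h k a
    using T.hom_mult[OF that(1,2)] aut[OF that(1)] aut[OF that(2)] that(3)
    by (simp add: AutoGroup_def BijGroup_def auto_def compose_def)
  have act1: "\<theta> \<one>\<^bsub>H\<^esub> a = a" if "a \<in> carrier N" for a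
    using T.hom_one that by (simp add: AutoGroup_def BijGroup_def)
  have th1: "\<theta> h \<one>\<^bsub>N\<^esub> = \<one>\<^bsub>N\<^esub>" if "h \<in> carrier H" for h
  proof -
    have "\<theta> h \<one>\<^bsub>N\<^esub> \<otimes>\<^bsub>N\<^esub> \<theta> h \<one>\<^bsub>N\<^esub> = \<theta> h \<one>\<^bsub>N\<^esub>"
      using dist[OF that N.one_closed N.one_closed] by simp
    then show ?thesis
      using N.l_cancel_one closed[OF that N.one_closed] by blast
  qed
  show ?thesis
  proof (rule groupI)
    fix x assume "x \<in> carrier (semidirect_product N H \<theta>)"
    then obtain a h where x: "x = (a, h)" and a: "a \<in> carrier N" and h: "h \<in> carrier H"
      by (auto simp: semidirect_product_def)
    let ?y = "(\<theta> (inv\<^bsub>H\<^esub> h) (inv\<^bsub>N\<^esub> a), inv\<^bsub>H\<^esub> h)"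
    have "?y \<in> carrier (semidirect_product N H \<theta>)"
      using a h by (simp add: semidirect_product_def closed del: T.hom_inv)
    moreover have "?y \<otimes>\<^bsub>semidirect_product N H \<theta>\<^esub> x = \<one>\<^bsub>semidirect_product N H \<theta>\<^esub>"
      using a h dist[of "inv\<^bsub>H\<^esub> h" "inv\<^bsub>N\<^esub> a" a] by (simp add: x semidirect_product_def th1 del: T.hom_inv)
    ultimately show "\<exists>y\<in>carrier (semidirect_product N H \<theta>).
        y \<otimes>\<^bsub>semidirect_product N H \<theta>\<^esub> x = \<one>\<^bsub>semidirect_product N H \<theta>\<^esub>"
      by blast
  qed (auto simp: semidirect_product_def closed dist act act1 N.m_assoc H.m_assoc
      simp del: T.hom_mult T.hom_one)
qed

definition symmetric_generating_set :: "('g, 'm) monoid_scheme \<Rightarrow> 'g set \<Rightarrow> bool" where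
  "symmetric_generating_set \<Gamma> A \<longleftrightarrow>
     A \<subseteq> carrier \<Gamma> \<and> generate \<Gamma> A = carrier \<Gamma> \<and> (\<forall>a\<in>A. inv\<^bsub>\<Gamma>\<^esub> a \<in> A)"

definition finitely_generated :: "('g, 'm) monoid_scheme \<Rightarrow> bool" where
  "finitely_generated \<Gamma> \<longleftrightarrow> (\<exists>S. finite S \<and> S \<subseteq> carrier \<Gamma> \<and> generate \<Gamma> S = carrier \<Gamma>)"

text \<open>Words over \<open>A\<close> are the elements of \<^term>\<open>lists A\<close>.\<close>

definition word_value :: "('g, 'm) monoid_scheme \<Rightarrow> 'g list \<Rightarrow> 'g" where
  "word_value \<Gamma> w = foldr (\<lambda>a b. a \<otimes>\<^bsub>\<Gamma>\<^esub> b) w \<one>\<^bsub>\<Gamma>\<^esub>"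

definition Geo :: "('g, 'm) monoid_scheme \<Rightarrow> 'g set \<Rightarrow> 'g list set" where
  "Geo \<Gamma> A = {w \<in> lists A.
     \<not> (\<exists>v\<in>lists A. length v < length w \<and> word_value \<Gamma> v = word_value \<Gamma> w)}"

text \<open>Piecewise subwords are not necessarily contiguous, i.e. they are given by \<^const>\<open>list_emb\<close>
  over equality, abbreviated \<open>subseq\<close>.\<close>

definition piecewise_excluding :: "'a set \<Rightarrow> 'a list set \<Rightarrow> bool" where
  "piecewise_excluding A L \<longleftrightarrow> L \<subseteq> lists A \<and>
     (\<exists>F. finite F \<and> F \<subseteq> lists A \<and>
       (\<forall>w\<in>lists A. w \<in> L \<longleftrightarrow> \<not> (\<exists>f\<in>F. subseq f w)))"

end

theory Submission
  imports Defs
begin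

text \<open>In both cases \<open>G\<close> acts on \<open>\<int>\<close> as an infinite dihedral group, through the coordinate \<open>a i\<close> or
  the difference \<open>a i - a j\<close>. Write \<open>x \<mapsto> \<epsilon> g * x + d g\<close> for the resulting action of \<open>g \<in> \<Gamma>\<close>.
  Piecewise excluding languages are closed under subsequences, so it suffices to find \<open>a, b \<in> A\<close>
  such that the conjugate \<open>a b a\<inverse>\<close> is a geodesic word: its subsequence \<open>a a\<inverse>\<close> is not geodesic.
  Let \<open>r \<in> A\<close> be a reflection with \<open>d r\<close> maximal, and \<open>T\<close> the largest translation length in \<open>A\<close>.
  A reflection that is a word of length at most two has \<open>d \<le> d r + T\<close>. If \<open>T > 0\<close> is attained by \<open>t\<close>,
  then \<open>t r t\<inverse>\<close> has \<open>d = d r + 2 * T\<close>. If \<open>T = 0\<close>, there is a reflection \<open>s \<in> A\<close> with \<open>d s < d r\<close>, and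
  \<open>r s r\<inverse>\<close> has \<open>d = 2 * d r - d s > d r\<close>.\<close>

section \<open>Piecewise excluding languages\<close>

text \<open>\<open>subseq\<close> is transitive, so a forbidden subword of \<open>v\<close> would
  also be one of \<open>w\<close>.\<close>

lemma piecewise_excluding_subseq:
  assumes "piecewise_excluding A L" "w \<in> L" "v \<in> lists A" "subseq v w"
  shows "v \<in> L"
proof -
  obtain F where F: "\<And>u. u \<in> lists A \<Longrightarrow> u \<in> L \<longleftrightarrow> \<not> (\<exists>f\<in>F. subseq f u)" and "L \<subseteq> lists A"
    using assms(1) unfolding piecewise_excluding_def by metis
  moreover have "w \<in> lists A"
    using \<open>L \<subseteq> lists A\<close> assms(2) by blast
  ultimately show ?thesis
    using assms(2-4) subseq_order.trans by metis
qed

section \<open>Geodesics under an infinite dihedral action\<close>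

text \<open>\<open>\<epsilon>\<close> is the linear part and \<open>d\<close> the value at 0 of an
  affine map of the integers; the two product laws are composition of such maps. The existence
  assumptions make the image infinite dihedral.\<close>

locale dihedral_action = group \<Gamma> for \<Gamma> :: "('g, 'm) monoid_scheme" (structure) +
  fixes \<epsilon> d :: "'g \<Rightarrow> int"
  assumes sign: "x \<in> carrier \<Gamma> \<Longrightarrow> \<epsilon> x = 1 \<or> \<epsilon> x = -1"
    and sign_mult: "x \<in> carrier \<Gamma> \<Longrightarrow> y \<in> carrier \<Gamma> \<Longrightarrow> \<epsilon> (x \<otimes> y) = \<epsilon> x * \<epsilon> y"
    and disp_mult: "x \<in> carrier \<Gamma> \<Longrightarrow> y \<in> carrier \<Gamma> \<Longrightarrow> d (x \<otimes> y) = d x + \<epsilon> x * d y"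
    and reflection: "\<exists>x\<in>carrier \<Gamma>. \<epsilon> x = -1"
    and translation: "\<exists>x\<in>carrier \<Gamma>. \<epsilon> x = 1 \<and> d x \<noteq> 0"
begin

lemma sign_one: "\<epsilon> \<one> = 1"
  using sign_mult[of \<one> \<one>] sign[of \<one>] by auto

lemma disp_one: "d \<one> = 0"
  using disp_mult[of \<one> \<one>] by (simp add: sign_one)

lemma sign_inv: "x \<in> carrier \<Gamma> \<Longrightarrow> \<epsilon> (inv x) = \<epsilon> x"
  using sign_mult[of x "inv x"] sign[of x] sign[of "inv x"] by (auto simp: sign_one)

lemma disp_inv: "x \<in> carrier \<Gamma> \<Longrightarrow> d (inv x) = - \<epsilon> x * d x"
  using disp_mult[of x "inv x"] sign[of x] by (auto simp: disp_one)

text \<open>The reflection \<open>y\<close> fixes \<open>d y / 2\<close>, and its conjugate by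
  \<open>x\<close> fixes the image of that point under \<open>x\<close>; doubling this image gives
  the displacement.\<close>

lemma disp_conj:
  assumes "x \<in> carrier \<Gamma>" "y \<in> carrier \<Gamma>" "\<epsilon> y = -1"
  shows "\<epsilon> (x \<otimes> (y \<otimes> inv x)) = -1" "d (x \<otimes> (y \<otimes> inv x)) = d x + \<epsilon> x * d y + d x"
  using assms sign[of x] by (auto simp: sign_mult disp_mult sign_inv disp_inv)

lemma not_piecewise_excluding_Geo:
  assumes A: "finite A" "symmetric_generating_set \<Gamma> A"
  shows "\<not> piecewise_excluding A (Geo \<Gamma> A)"
proof
  assume pe: "piecewise_excluding A (Geo \<Gamma> A)"
  have Ac: "A \<subseteq> carrier \<Gamma>" and gen: "generate \<Gamma> A = carrier \<Gamma>" and Ainv: "\<And>a. a \<in> A \<Longrightarrow> inv a \<in> A"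
    using A by (auto simp: symmetric_generating_set_def)
  have gen_sub: "carrier \<Gamma> \<subseteq> H" if "A \<subseteq> H" "subgroup H \<Gamma>" for H
    using generate_subgroup_incl[OF that] gen by simp
  define R where "R = {a\<in>A. \<epsilon> a = -1}"
  have finR: "finite (d ` R)"
    using A by (simp add: R_def)
  \<comment> \<open>Without reflections in \<open>A\<close>, all generators would lie in the kernel
    of \<open>\<epsilon>\<close>, a proper subgroup.\<close>
  have "R \<noteq> {}"
  proof
    assume "R = {}"
    then have "A \<subseteq> {x\<in>carrier \<Gamma>. \<epsilon> x = 1}"
      using Ac sign by (force simp: R_def)
    moreover have "subgroup {x\<in>carrier \<Gamma>. \<epsilon> x = 1} \<Gamma>"
      by unfold_locales (auto simp: sign_mult sign_one sign_inv)
    ultimately have "carrier \<Gamma> \<subseteq> {x\<in>carrier \<Gamma>. \<epsilon> x = 1}"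
      by (rule gen_sub)
    then show False
      using reflection by auto
  qed
  then obtain r where r: "r \<in> R" "d r = Max (d ` R)"
    using Max_in[OF finR] by (metis imageE image_is_empty)
  have rA: "r \<in> A" "\<epsilon> r = -1"
    using r by (auto simp: R_def)
  have rmax: "d x \<le> d r" if "x \<in> A" "\<epsilon> x = -1" for x
    using that r finR by (simp add: R_def)
  \<comment> \<open>Shared by both final cases. \<open>T\<close> bounds the translations in
    \<open>A\<close>, and \<open>big\<close> puts the conjugate of \<open>b\<close> by
    \<open>a\<close> beyond every reflection spelled by at most two letters.\<close>
  have conj: False
    if ab: "a \<in> A" "b \<in> A" "\<epsilon> b = -1"
      and T: "0 \<le> T" "\<And>x. x \<in> A \<Longrightarrow> \<epsilon> x = 1 \<Longrightarrow> d x \<le> T"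
      and big: "d r + T < d a + \<epsilon> a * d b + d a" for a b T
  proof -
    have ac: "a \<in> carrier \<Gamma>" "b \<in> carrier \<Gamma>"
      using ab Ac by auto
    have short: "d (word_value \<Gamma> v) \<le> d r + T"
      if v: "v \<in> lists A" "length v < 3" "\<epsilon> (word_value \<Gamma> v) = -1" for v
    proof -
      consider "v = []" | x where "v = [x]" | x y where "v = [x, y]"
        using v(2) by (cases v; cases "tl v"; cases "tl (tl v)") auto
      then show ?thesis
      proof cases
        case 1
        then show ?thesis
          using v(3) by (simp add: word_value_def sign_one)
      next
        case 2
        then have "x \<in> A" "x \<in> carrier \<Gamma>"
          using v(1) Ac by auto
        then show ?thesis
          using 2 v(3) rmax[of x] T(1) by (simp add: word_value_def)
      next
        case 3
        then have xy: "x \<in> A" "x \<in> carrier \<Gamma>" "y \<in> A" "y \<in> carrier \<Gamma>"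
          using v(1) Ac by auto
        have val: "word_value \<Gamma> v = x \<otimes> y"
          using 3 xy by (simp add: word_value_def)
        have "\<epsilon> x * \<epsilon> y = -1"
          using v(3) xy by (simp add: val sign_mult)
        then have "\<epsilon> x = 1 \<and> \<epsilon> y = -1 \<or> \<epsilon> x = -1 \<and> \<epsilon> y = 1"
          using sign[of x] sign[of y] xy by auto
        then show ?thesis
        proof
          assume "\<epsilon> x = 1 \<and> \<epsilon> y = -1"
          then show ?thesis
            using rmax[of y] T(2)[of x] xy by (simp add: val disp_mult)
        next
          \<comment> \<open>Here the product has displacement \<open>d x - d y\<close>, and
            \<open>- d y\<close> is the displacement of \<open>inv y\<close>, which is in
            \<open>A\<close> by symmetry.\<close>
          assume "\<epsilon> x = -1 \<and> \<epsilon> y = 1"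
          then show ?thesis
            using rmax[of x] T(2)[of "inv y"] xy Ainv
            by (simp add: val disp_mult sign_inv disp_inv)
        qed
      qed
    qed
    have val: "word_value \<Gamma> [a, b, inv a] = a \<otimes> (b \<otimes> inv a)"
      using ac by (simp add: word_value_def)
    \<comment> \<open>A shorter word with the same value would be a reflection violating
      \<open>short\<close>.\<close>
    have "[a, b, inv a] \<in> Geo \<Gamma> A"
      unfolding Geo_def using ab Ainv short big disp_conj[OF ac ab(3)] val
      by (fastforce simp del: One_nat_def)
    then have "[a, inv a] \<in> Geo \<Gamma> A"
      using piecewise_excluding_subseq[OF pe, of "[a, b, inv a]" "[a, inv a]"] ab Ainv by simp
    moreover have "word_value \<Gamma> [] = word_value \<Gamma> [a, inv a]"
      using ac by (simp add: word_value_def)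
    ultimately show False
      by (force simp: Geo_def)
  qed
  show False
  proof (cases "\<exists>t\<in>A. \<epsilon> t = 1 \<and> d t \<noteq> 0")
    case True
    define P where "P = {a\<in>A. \<epsilon> a = 1}"
    have finP: "finite (d ` P)"
      using A by (simp add: P_def)
    obtain u where u: "u \<in> A" "\<epsilon> u = 1" "d u \<noteq> 0"
      using True by blast
    \<comment> \<open>\<open>d u\<close> may be negative; including \<open>inv u\<close> makes the
      maximum positive in either case.\<close>
    then have "u \<in> P" "inv u \<in> P"
      using Ac Ainv by (auto simp: P_def sign_inv)
    then obtain t where t: "t \<in> P" "d t = Max (d ` P)"
      using Max_in[OF finP] by (metis imageE image_is_empty empty_iff)
    then have tmax: "d x \<le> d t" if "x \<in> P" for x
      using that finP by simp
    have "d u \<le> d t" "- d u \<le> d t"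
      using tmax[OF \<open>u \<in> P\<close>] tmax[OF \<open>inv u \<in> P\<close>] u Ac by (auto simp: disp_inv)
    then have "0 < d t"
      using u(3) by linarith
    then show False
      using conj[of t r "d t"] t(1) rA tmax by (simp add: P_def)
  next
    case False
    \<comment> \<open>\<open>?H\<close> is the stabilizer of \<open>d r / 2\<close>, the fixed point
      of \<open>r\<close>. A nontrivial translation lies outside it, hence so does some
      generator.\<close>
    let ?H = "{x\<in>carrier \<Gamma>. \<epsilon> x = 1 \<and> d x = 0 \<or> \<epsilon> x = -1 \<and> d x = d r}"
    have "subgroup ?H \<Gamma>"
      by unfold_locales
        (auto simp: sign_mult disp_mult sign_one disp_one sign_inv disp_inv)
    moreover obtain g where "g \<in> carrier \<Gamma>" "g \<notin> ?H"
      using translation by auto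
    ultimately obtain s where "s \<in> A" "s \<notin> ?H"
      using gen_sub by blast
    \<comment> \<open>Translations in \<open>A\<close> are now trivial and lie in \<open>?H\<close>,
      so \<open>s\<close> is a reflection; as \<open>d s\<close> differs from \<open>d r\<close>,
      maximality makes the inequality strict.\<close>
    then have s: "s \<in> A" "\<epsilon> s = -1" "d s < d r"
      using False Ac sign[of s] rmax[of s] by force+
    show False
      using conj[of r s 0] s rA False by force
  qed
qed

end

section \<open>The free abelian group\<close>

lemma carrier_free_abelian: "carrier (free_abelian n) = {1..n} \<rightarrow>\<^sub>E UNIV"
  by (simp add: free_abelian_def)

lemma mult_free_abelian:
  "a \<otimes>\<^bsub>free_abelian n\<^esub> b = (\<lambda>k\<in>{1..n}. a k + b k)"
  by (simp add: free_abelian_def)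

lemma group_free_abelian: "group (free_abelian n)"
  by (simp add: free_abelian_def)

lemma inv_free_abelian:
  assumes "a \<in> carrier (free_abelian n)"
  shows "inv\<^bsub>free_abelian n\<^esub> a = (\<lambda>k\<in>{1..n}. - a k)"
  using assms by (simp add: free_abelian_def)

lemma basis_elt_carrier [simp]: "basis_elt n i \<in> carrier (free_abelian n)"
  by (simp add: carrier_free_abelian basis_elt_def)

lemma basis_elt_apply: "l \<in> {1..n} \<Longrightarrow> basis_elt n k l = (if l = k then 1 else 0)"
  by (simp add: basis_elt_def)

text \<open>Every element is a finite product of integer powers of basis elements. This serves to
  extend an identity from the basis, where the action is prescribed, to all elements.\<close>

lemma additive_free_abelian_eq_0:
  fixes f :: "(nat \<Rightarrow> int) \<Rightarrow> int"
  assumes add: "\<And>a b. a \<in> carrier (free_abelian n) \<Longrightarrow> b \<in> carrier (free_abelian n) \<Longrightarrow>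
      f (a \<otimes>\<^bsub>free_abelian n\<^esub> b) = f a + f b"
    and basis: "\<And>k. k \<in> {1..n} \<Longrightarrow> f (basis_elt n k) = 0"
    and a: "a \<in> carrier (free_abelian n)"
  shows "f a = 0"
proof -
  \<comment> \<open>For \<open>k\<close> in \<open>{1..n}\<close>, \<open>s k z\<close> is the
    \<open>z\<close>-th power of the \<open>k\<close>-th basis element.\<close>
  define s :: "nat \<Rightarrow> int \<Rightarrow> nat \<Rightarrow> int" where "s k z = (\<lambda>l\<in>{1..n}. if l = k then z else 0)" for k z
  have sc: "s k z \<in> carrier (free_abelian n)" for k z
    by (simp add: s_def carrier_free_abelian)
  have s_add: "f (s k (z + w)) = f (s k z) + f (s k w)" for k z w
  proof -
    have "s k (z + w) = s k z \<otimes>\<^bsub>free_abelian n\<^esub> s k w"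
      by (auto simp: s_def mult_free_abelian)
    then show ?thesis
      using add[OF sc sc] by simp
  qed
  have s1: "f (s k 1) = 0" if "k \<in> {1..n}" for k
    using basis[OF that] by (simp add: s_def basis_elt_def)
  have s0: "f (s k z) = 0" if "k \<in> {1..n}" for k z
  proof (induction z rule: int_induct[where k = 0])
    case base
    show ?case
      using s_add[of k 0 0] by simp
  next
    case (step1 i)
    then show ?case
      using s_add[of k i 1] s1[OF that] by simp
  next
    case (step2 i)
    then show ?case
      using s_add[of k "i - 1" 1] s1[OF that] by simp
  qed
  \<comment> \<open>\<open>p S\<close> keeps only the coordinates of \<open>a\<close> in
    \<open>S\<close>, so that \<open>a\<close> is assembled one coordinate at a time.\<close>
  define p where "p S = (\<lambda>l\<in>{1..n}. if l \<in> S then a l else 0)" for S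
  have "f (p S) = 0" if "finite S" "S \<subseteq> {1..n}" for S
    using that
  proof (induction S)
    case empty
    \<comment> \<open>\<open>s 0 0\<close> is the neutral element, where additivity forces the value
      0.\<close>
    have "p {} = s 0 0"
      by (auto simp: s_def p_def)
    then show ?case
      using s_add[of 0 0 0] by simp
  next
    case (insert k S)
    have "p (insert k S) = p S \<otimes>\<^bsub>free_abelian n\<^esub> s k (a k)"
      using insert.hyps by (auto simp: s_def p_def mult_free_abelian)
    moreover have "p S \<in> carrier (free_abelian n)"
      by (simp add: p_def carrier_free_abelian)
    ultimately show ?case
      using insert s0[of k "a k"] add sc by simp
  qed
  moreover have "p {1..n} = a"
    using a by (auto simp: p_def carrier_free_abelian PiE_def extensional_def)
  ultimately show ?thesis
    by blast
qed

section \<open>Reduction to a dihedral action\<close>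

theorem corollary3p12:
  fixes n :: nat
    and \<theta> :: "int \<Rightarrow> (nat \<Rightarrow> int) \<Rightarrow> (nat \<Rightarrow> int)"
    and \<phi> :: "(nat \<Rightarrow> int) \<Rightarrow> (nat \<Rightarrow> int)"
    and G :: "((nat \<Rightarrow> int) \<times> int) monoid"
    and \<Gamma> :: "('g, 'm) monoid_scheme"
    and K :: "'g set"
  assumes action: "\<theta> \<in> hom (integer_mod_group 2) (AutoGroup (free_abelian n))"
    and phi: "\<phi> = \<theta> 1"
    and cases:
      "(\<exists>i\<in>{1..n}.
          \<phi> (basis_elt n i) = inv\<^bsub>free_abelian n\<^esub> (basis_elt n i) \<and>
          (\<forall>k\<in>{1..n} - {i}. \<phi> (basis_elt n k) = basis_elt n k))
       \<or> (\<exists>i\<in>{1..n}. \<exists>j\<in>{1..n}. i \<noteq> j \<and>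
          \<phi> (basis_elt n i) = basis_elt n j \<and>
          (\<forall>k\<in>{1..n} - {i, j}. \<phi> (basis_elt n k) = basis_elt n k))"
    and G: "G = semidirect_product (free_abelian n) (integer_mod_group 2) \<theta>"
    and Gamma: "group \<Gamma>" "finitely_generated \<Gamma>"
    and quotient: "K \<lhd> \<Gamma>" "\<Gamma> Mod K \<cong> G"
  shows "\<forall>A. finite A \<and> symmetric_generating_set \<Gamma> A \<longrightarrow> \<not> piecewise_excluding A (Geo \<Gamma> A)"
proof -
  define N where "N = free_abelian n"
  interpret N: group N
    by (simp add: N_def group_free_abelian)
  interpret A: group "AutoGroup N"
    by (rule N.AutoGroup)
  interpret \<Gamma>: group \<Gamma>
    by (fact Gamma)
  interpret K: normal K \<Gamma>
    by (fact quotient)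
  interpret Z2: group "integer_mod_group 2"
    by simp
  interpret T: group_hom "integer_mod_group 2" "AutoGroup N" \<theta>
    by unfold_locales (use action in \<open>simp add: N_def\<close>)
  have carrier2: "carrier (integer_mod_group 2) = {0, 1}"
    by (auto simp: carrier_integer_mod_group)
  have "\<phi> \<in> carrier (AutoGroup N)"
    unfolding phi by (rule T.hom_closed) (simp add: carrier2)
  then have aut: "\<phi> \<in> auto N"
    by (simp add: AutoGroup_def)
  have phi_closed: "\<phi> a \<in> carrier N" if "a \<in> carrier N" for a
    using aut that by (auto simp: auto_def hom_def)
  have phi_mult: "\<phi> (a \<otimes>\<^bsub>N\<^esub> b) = \<phi> a \<otimes>\<^bsub>N\<^esub> \<phi> b" if "a \<in> carrier N" "b \<in> carrier N" for a b
    using aut that by (auto simp: auto_def hom_def)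
  have theta0: "\<theta> 0 a = a" if "a \<in> carrier N" for a
    using T.hom_one that by (simp add: AutoGroup_def BijGroup_def one_integer_mod_group)
  have phi_phi: "\<phi> (\<phi> a) = a" if "a \<in> carrier N" for a
  proof -
    have "\<theta> (1 \<otimes>\<^bsub>integer_mod_group 2\<^esub> 1) = \<theta> 1 \<otimes>\<^bsub>AutoGroup N\<^esub> \<theta> 1"
      by (rule T.hom_mult) (simp_all add: carrier2)
    then have "\<theta> 0 a = (\<phi> \<otimes>\<^bsub>AutoGroup N\<^esub> \<phi>) a"
      by (simp add: phi mult_integer_mod_group)
    then show ?thesis
      using aut that theta0 by (simp add: AutoGroup_def BijGroup_def auto_def compose_def)
  qed
  \<comment> \<open>All that is needed of either case is a nonzero additive functional negated by
    \<open>\<phi>\<close>: the coordinate at \<open>i\<close>, or the difference of the coordinates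
    at \<open>i\<close> and \<open>j\<close>.\<close>
  obtain L :: "(nat \<Rightarrow> int) \<Rightarrow> int" where
    L_add: "\<And>a b. L (a \<otimes>\<^bsub>N\<^esub> b) = L a + L b"
    and L_basis: "\<And>k. k \<in> {1..n} \<Longrightarrow> L (\<phi> (basis_elt n k)) = - L (basis_elt n k)"
    and L_nz: "\<exists>a\<in>carrier N. L a \<noteq> 0"
    using cases
  proof (elim disjE bexE conjE)
    fix i assume i: "i \<in> {1..n}" "\<phi> (basis_elt n i) = inv\<^bsub>free_abelian n\<^esub> (basis_elt n i)"
      "\<forall>k\<in>{1..n} - {i}. \<phi> (basis_elt n k) = basis_elt n k"
    show thesis
    proof (rule that[of "\<lambda>a. a i"])
      show "\<phi> (basis_elt n k) i = - basis_elt n k i" if "k \<in> {1..n}" for k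
        using that i by (cases "k = i") (auto simp: inv_free_abelian basis_elt_apply)
      show "\<exists>a\<in>carrier N. a i \<noteq> 0"
        using i by (intro bexI[of _ "basis_elt n i"]) (auto simp: N_def basis_elt_apply)
    qed (use i in \<open>auto simp: N_def mult_free_abelian\<close>)
  next
    fix i j assume i: "i \<in> {1..n}" "j \<in> {1..n}" "i \<noteq> j" "\<phi> (basis_elt n i) = basis_elt n j"
      "\<forall>k\<in>{1..n} - {i, j}. \<phi> (basis_elt n k) = basis_elt n k"
    \<comment> \<open>The second case prescribes only the image of the \<open>i\<close>-th basis
      element; that of the \<open>j\<close>-th follows because \<open>\<phi>\<close> is an
      involution.\<close>
    have j: "\<phi> (basis_elt n j) = basis_elt n i"
      using phi_phi[of "basis_elt n i"] i(4) by (simp add: N_def)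
    show thesis
    proof (rule that[of "\<lambda>a. a i - a j"])
      show "\<phi> (basis_elt n k) i - \<phi> (basis_elt n k) j = - (basis_elt n k i - basis_elt n k j)"
        if k: "k \<in> {1..n}" for k
      proof -
        consider "k = i" | "k = j" | "k \<in> {1..n} - {i, j}"
          using k by blast
        then show ?thesis
          by cases (use i j in \<open>auto simp: basis_elt_apply\<close>)
      qed
      show "\<exists>a\<in>carrier N. a i - a j \<noteq> 0"
        using i by (intro bexI[of _ "basis_elt n i"]) (auto simp: N_def basis_elt_apply)
    qed (use i in \<open>auto simp: N_def mult_free_abelian\<close>)
  qed
  have L_phi: "L (\<phi> a) = - L a" if "a \<in> carrier N" for a
  proof -
    \<comment> \<open>The sum of \<open>L\<close> after \<open>\<phi>\<close> and \<open>L\<close>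
      is additive and vanishes on the basis.\<close>
    have "L (\<phi> a) + L a = 0"
      using that unfolding N_def
      by (rule additive_free_abelian_eq_0[where f = "\<lambda>a. L (\<phi> a) + L a", rotated 2])
        (simp_all add: L_basis flip: N_def, simp add: phi_mult L_add)
    then show ?thesis
      by simp
  qed
  have G_carrier: "carrier G = carrier N \<times> {0, 1}"
    by (simp add: G semidirect_product_def carrier2 N_def)
  have G_mult: "(a, h) \<otimes>\<^bsub>G\<^esub> (b, k) = (a \<otimes>\<^bsub>N\<^esub> \<theta> h b, (h + k) mod 2)" for a b h k
    by (simp add: G semidirect_product_def N_def mult_integer_mod_group)
  obtain \<psi> where \<psi>: "\<psi> \<in> iso (\<Gamma> Mod K) G"
    using quotient(2) by (auto simp: is_iso_def)
  \<comment> \<open>The surjection from \<open>\<Gamma>\<close> onto \<open>G\<close>: the quotient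
    map followed by the isomorphism.\<close>
  define \<pi> where "\<pi> x = \<psi> (K #>\<^bsub>\<Gamma>\<^esub> x)" for x
  have pi_closed: "\<pi> x \<in> carrier G" if "x \<in> carrier \<Gamma>" for x
    using \<psi> that 
    by (auto simp: \<pi>_def iso_def hom_def FactGroup_def RCOSETS_def)
  have pi_mult: "\<pi> (x \<otimes>\<^bsub>\<Gamma>\<^esub> y) = \<pi> x \<otimes>\<^bsub>G\<^esub> \<pi> y" if "x \<in> carrier \<Gamma>" "y \<in> carrier \<Gamma>" for x y
  proof -
    have "\<psi> \<circ> (#>\<^bsub>\<Gamma>\<^esub>) K \<in> hom \<Gamma> G"
      using K.r_coset_hom_Mod \<psi> by (intro hom_compose) (auto simp: iso_def)
    then show ?thesis
      using that by (auto simp: hom_def \<pi>_def)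
  qed
  have pi_surj: "\<exists>x\<in>carrier \<Gamma>. \<pi> x = g" if "g \<in> carrier G" for g
  proof -
    obtain c where "c \<in> carrier (\<Gamma> Mod K)" "\<psi> c = g"
      using \<psi> \<open>g \<in> carrier G\<close> by (force simp: iso_def bij_betw_def)
    then show ?thesis
      by (auto simp: \<pi>_def FactGroup_def RCOSETS_def)
  qed
  \<comment> \<open>The second component gives the sign. Since \<open>\<theta> 1\<close> negates
    \<open>L\<close>, applying \<open>L\<close> to the first component turns the semidirect product
    law into the affine one.\<close>
  define \<epsilon> d :: "'g \<Rightarrow> int"
    where "\<epsilon> x = (if snd (\<pi> x) = 0 then 1 else -1)" and "d x = L (fst (\<pi> x))" for x
  interpret dihedral_action \<Gamma> \<epsilon> d
  proof unfold_locales
    fix x assume "x \<in> carrier \<Gamma>"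
    show "\<epsilon> x = 1 \<or> \<epsilon> x = -1"
      by (simp add: \<epsilon>_def)
  next
    fix x y assume xy: "x \<in> carrier \<Gamma>" "y \<in> carrier \<Gamma>"
    obtain a h b k where ah: "\<pi> x = (a, h)" "\<pi> y = (b, k)"
      by (meson surj_pair)
    then have "a \<in> carrier N" "b \<in> carrier N" "h = 0 \<or> h = 1" "k = 0 \<or> k = 1"
      using pi_closed[OF xy(1)] pi_closed[OF xy(2)] by (auto simp: G_carrier)
    then show "\<epsilon> (x \<otimes>\<^bsub>\<Gamma>\<^esub> y) = \<epsilon> x * \<epsilon> y" "d (x \<otimes>\<^bsub>\<Gamma>\<^esub> y) = d x + \<epsilon> x * d y"
      by (auto simp: \<epsilon>_def d_def pi_mult xy ah G_mult theta0 L_add L_phi simp flip: phi)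
  next
    show "\<exists>x\<in>carrier \<Gamma>. \<epsilon> x = -1"
      using pi_surj[of "(\<one>\<^bsub>N\<^esub>, 1)"] by (force simp: G_carrier \<epsilon>_def)
  next
    obtain a where "a \<in> carrier N" "L a \<noteq> 0"
      using L_nz by blast
    then show "\<exists>x\<in>carrier \<Gamma>. \<epsilon> x = 1 \<and> d x \<noteq> 0"
      using pi_surj[of "(a, 0)"] by (force simp: G_carrier \<epsilon>_def d_def)
  qed
  show ?thesis
    using not_piecewise_excluding_Geo by blast
qed

end
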